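(* Let $\mathcal H$ be a real Hilbert space, let $\Phi:\mathcal H\to\mathbb R$ be convex and differentiable with $L$-Lipschitz continuous gradient ($L>0$), let $\Psi:\mathcal H\to\mathbb R\cup\{+\infty\}$ be convex, proper and lower semicontinuous, and suppose that $\Phi+\Psi$ has a nonempty set of minimizers. Let $s\in\,]0,1/L]$ and $0<\alpha\le 3$. Let $(x_k)$ be a sequence generated, from initial points $x_0,x_1\in\mathcal H$, by the algorithm: for $k\ge 1$, $$y_k=x_k+\left(1-\frac{\alpha}{k}\right)(x_k-x_{k-1}),\qquad x_{k+1}=\mathrm{prox}_{s\Psi}\big(y_k-s\nabla\Phi(y_k)\big).$$ Then, for all $p<\frac{2\alpha}{3}$, $$(\Phi+\Psi)(x_k)-\min_{\mathcal H}(\Phi+\Psi)=\mathcal O\left(\frac{1}{k^p}\right)\quad\text{as } k\to+\infty .$$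
   Context: For $\gamma>0$ and $x\in\mathcal H$, $\mathrm{prox}_{\gamma\Psi}(x)=\operatorname{argmin}_{\xi\in\mathcal H}\left\{\Psi(\xi)+\frac{1}{2\gamma}\|\xi-x\|^2\right\}=(I+\gamma\,\partial\Psi)^{-1}(x)$, where $\partial\Psi$ is the convex subdifferential. *)

theory Defs
  imports "HOL-Analysis.Analysis" "HOL-Library.Landau_Symbols"
begin

text \<open>Functions with values in \<open>\<real> \<union> {+\<infinity>}\<close> are functions into \<^typ>\<open>ereal\<close>; properness excludes the
  value \<open>-\<infinity>\<close>. A real Hilbert space is a type of sort \<open>{real_inner, complete_space}\<close>.\<close>

definition proper_fun :: "('a \<Rightarrow> ereal) \<Rightarrow> bool"
  where "proper_fun f \<longleftrightarrow> (\<forall>x. f x \<noteq> -\<infinity>) \<and> (\<exists>x. f x \<noteq> \<infinity>)"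

text \<open>The library predicate \<^const>\<open>convex_on\<close> covers only real-valued functions. At the endpoints
  the convention \<open>0 * \<infinity> = 0\<close> of \<^typ>\<open>ereal\<close> makes the inequality trivially true.\<close>

definition convex_fun :: "('a::real_vector \<Rightarrow> ereal) \<Rightarrow> bool"
  where "convex_fun f \<longleftrightarrow>
    (\<forall>x y. \<forall>u\<ge>0. \<forall>v\<ge>0. u + v = 1 \<longrightarrow>
      f (u *\<^sub>R x + v *\<^sub>R y) \<le> ereal u * f x + ereal v * f y)"

definition lsc_fun :: "('a::topological_space \<Rightarrow> ereal) \<Rightarrow> bool"
  where "lsc_fun f \<longleftrightarrow> (\<forall>x. f x \<le> Liminf (at x) f)"

text \<open>For \<open>\<gamma> > 0\<close> and \<open>\<Psi>\<close> proper, convex and lower semicontinuous on a Hilbert space the minimizer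
  exists and is unique, so the choice made by \<^const>\<open>arg_min\<close> is immaterial.\<close>

definition prox :: "real \<Rightarrow> ('a::real_inner \<Rightarrow> ereal) \<Rightarrow> 'a \<Rightarrow> 'a"
  where "prox \<gamma> \<Psi> x = (ARG_MIN (\<lambda>\<xi>. \<Psi> \<xi> + ereal (1 / (2 * \<gamma>) * (norm (\<xi> - x))\<^sup>2)) \<xi>. True)"

definition sum_fun :: "('a \<Rightarrow> real) \<Rightarrow> ('a \<Rightarrow> ereal) \<Rightarrow> 'a \<Rightarrow> ereal"
  where "sum_fun \<Phi> \<Psi> x = ereal (\<Phi> x) + \<Psi> x"

end

theory Submission
  imports Defs "HOL-Real_Asymp.Real_Asymp"
begin

text \<open>
  Let \<open>z\<close> be a minimizer of \<open>\<Phi> + \<Psi>\<close>, let \<open>m\<close> be the minimum,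
  \<open>\<theta> k = (\<Phi> + \<Psi>)(x k) - m\<close> and \<open>d k = x k - x (k - 1)\<close>.

  One forward-backward step from \<open>y\<close> to \<open>x'\<close> satisfies, for every \<open>v\<close>,
  \<open>2 s (\<Phi> + \<Psi>)(x') \<le> 2 s (\<Phi> + \<Psi>)(v) + \<parallel>y - v\<parallel>\<^sup>2 - \<parallel>x' - v\<parallel>\<^sup>2\<close>
  (\<open>forward_backward_descent\<close>). Taking \<open>v = x k\<close> with weight \<open>k (k - c)\<close> and \<open>v = z\<close> with
  weight \<open>k c\<close>, all squared distances collapse to two squares (\<open>weighted_descent\<close>):
  \<open>2 s (k\<^sup>2 \<theta> (k + 1) - k (k - c) \<theta> k)
    \<le> \<parallel>c (x k - z) + (k - \<alpha>) d k\<parallel>\<^sup>2 - \<parallel>c (x (k + 1) - z) + (k - c) d (k + 1)\<parallel>\<^sup>2\<close>.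

  For \<open>\<alpha> \<ge> 3\<close> the choice \<open>c = \<alpha> - 1\<close> would make the two squares telescope. For smaller \<open>\<alpha>\<close> the
  inequality is multiplied by the decreasing weight \<open>k powr (\<beta> - 2)\<close>, with \<open>0 < \<beta> < 2 \<alpha> / 3\<close>, and
  a multiple of \<open>\<parallel>x k - z\<parallel>\<^sup>2\<close> is added, which gives the energy
  \<open>F k = k powr (\<beta> - 2) * (2 s k\<^sup>2 \<theta> (k + 1) + \<parallel>c (x (k + 1) - z) + (k - c) d (k + 1)\<parallel>\<^sup>2
    + e \<parallel>x k - z\<parallel>\<^sup>2)\<close>.
  The increment of \<open>F\<close> is bounded by a term in \<open>\<theta> k\<close>, which is nonpositive for large \<open>k\<close> if
  \<open>\<beta> < c\<close>, and a quadratic form \<open>P \<parallel>X\<parallel>\<^sup>2 + 2 Q \<langle>X, d\<rangle> + R \<parallel>d\<parallel>\<^sup>2\<close> in \<open>X = x k - z\<close> and \<open>d = d k\<close>.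
  After division by the weight, \<open>P\<close> is of order \<open>-1 / k\<close>, and \<open>R\<close> is of order \<open>-k\<close> if
  \<open>c < \<alpha> - \<beta> / 2\<close>; the constant \<open>e\<close> is chosen such that \<open>Q\<close> tends to 0. Hence \<open>Q\<^sup>2 \<le> P R\<close> for
  large \<open>k\<close> and the form is nonpositive (\<open>eventually_dissipative\<close>). A suitable \<open>c\<close> exists exactly
  when \<open>\<beta> < \<alpha> - \<beta> / 2\<close>, that is \<open>\<beta> < 2 \<alpha> / 3\<close>: this is where the exponent comes from. So \<open>F\<close> is
  eventually nonincreasing and \<open>k powr \<beta> * \<theta> (k + 1)\<close> is bounded (\<open>inertial_rate\<close>).

  The step inequality needs that the proximal point really is a minimizer. Optimality of \<open>z\<close> shows
  that \<open>-grad\<Phi> z\<close> is a subgradient of \<open>\<Psi>\<close> at \<open>z\<close>, which gives \<open>\<Psi>\<close> an affine minorant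
  (\<open>minimizer_affine_minorant\<close>); then minimizing sequences of the proximal objective are Cauchy by strong
  convexity, and lower semicontinuity makes their limit a minimizer
  (\<open>prox_objective_has_minimizer\<close>).
\<close>

section \<open>Smooth convex functions\<close>

lemma convex_on_along_line:
  fixes f :: "'a::real_vector \<Rightarrow> real"
  assumes "convex_on UNIV f"
  shows "convex_on UNIV (\<lambda>t::real. f (u + t *\<^sub>R d))"
proof (rule convex_onI)
  fix t a b :: real
  assume t: "0 < t" "t < 1"
  have "u + ((1 - t) *\<^sub>R a + t *\<^sub>R b) *\<^sub>R d = (1 - t) *\<^sub>R (u + a *\<^sub>R d) + t *\<^sub>R (u + b *\<^sub>R d)"
    by (simp add: algebra_simps)
  then show "f (u + ((1 - t) *\<^sub>R a + t *\<^sub>R b) *\<^sub>R d) \<le> (1 - t) * f (u + a *\<^sub>R d) + t * f (u + b *\<^sub>R d)"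
    using convex_onD[OF assms, of t "u + a *\<^sub>R d" "u + b *\<^sub>R d"] t by simp
qed simp

lemma GDERIV_along_line:
  fixes f :: "'a::real_inner \<Rightarrow> real"
  assumes "GDERIV f (u + t *\<^sub>R d) :> g"
  shows "((\<lambda>t. f (u + t *\<^sub>R d)) has_real_derivative g \<bullet> d) (at t)"
proof -
  have "((\<lambda>t. u + t *\<^sub>R d) has_derivative (\<lambda>h. h *\<^sub>R d)) (at t)"
    by (auto intro!: derivative_eq_intros)
  moreover have "(f has_derivative (\<lambda>h. h \<bullet> g)) (at (u + t *\<^sub>R d))"
    using assms unfolding gderiv_def .
  ultimately have "((\<lambda>t. f (u + t *\<^sub>R d)) has_derivative (\<lambda>h. (h *\<^sub>R d) \<bullet> g)) (at t)"
    by (rule has_derivative_compose)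
  then show ?thesis
    by (simp add: has_field_derivative_def inner_commute mult_commute_abs)
qed

lemma convex_on_GDERIV_lower:
  fixes f :: "'a::real_inner \<Rightarrow> real"
  assumes "convex_on UNIV f" and "GDERIV f u :> g"
  shows "f u + g \<bullet> (v - u) \<le> f v"
proof -
  have "((\<lambda>t. f (u + t *\<^sub>R (v - u))) has_real_derivative g \<bullet> (v - u)) (at 0)"
    by (rule GDERIV_along_line) (simp add: assms)
  from convex_on_imp_above_tangent[OF convex_on_along_line[OF assms(1)], of 0 1, OF _ _ _ this]
  show ?thesis by simp
qed

text \<open>The function \<open>h\<close> below is \<open>f\<close> along the segment from \<open>u\<close> to \<open>v\<close> minus the claimed bound;
  the Lipschitz condition on \<open>g\<close> makes its derivative nonpositive.\<close>

lemma descent_lemma: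
  fixes f :: "'a::real_inner \<Rightarrow> real"
  assumes grad: "\<And>z. GDERIV f z :> g z" and lip: "L-lipschitz_on UNIV g"
  shows "f v \<le> f u + g u \<bullet> (v - u) + L / 2 * (norm (v - u))\<^sup>2"
proof -
  define d where "d = v - u"
  define h where "h t = f (u + t *\<^sub>R d) - t * (g u \<bullet> d) - L / 2 * t\<^sup>2 * (norm d)\<^sup>2" for t
  have "h 1 \<le> h 0"
  proof (rule DERIV_nonpos_imp_nonincreasing[of 0 1 h])
    fix t :: real assume t: "0 \<le> t" "t \<le> 1"
    have "(h has_real_derivative g (u + t *\<^sub>R d) \<bullet> d - g u \<bullet> d - L * t * (norm d)\<^sup>2) (at t)"
      unfolding h_def
      by (rule derivative_eq_intros GDERIV_along_line grad refl | simp)+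
    moreover have "g (u + t *\<^sub>R d) \<bullet> d - g u \<bullet> d \<le> L * t * (norm d)\<^sup>2"
    proof -
      have "g (u + t *\<^sub>R d) \<bullet> d - g u \<bullet> d \<le> norm (g (u + t *\<^sub>R d) - g u) * norm d"
        by (metis inner_diff_left norm_cauchy_schwarz)
      also have "norm (g (u + t *\<^sub>R d) - g u) \<le> L * (t * norm d)"
        using lipschitz_onD[OF lip, of "u + t *\<^sub>R d" u] t by (simp add: dist_norm)
      finally show ?thesis by (simp add: power2_eq_square mult_right_mono mult.assoc)
    qed
    ultimately show "\<exists>y. (h has_real_derivative y) (at t) \<and> y \<le> 0"
      by (intro exI[of _ "g (u + t *\<^sub>R d) \<bullet> d - g u \<bullet> d - L * t * (norm d)\<^sup>2"]) simp
  qed simp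
  then show ?thesis by (simp add: h_def d_def)
qed

section \<open>Convex functions with extended real values\<close>

text \<open>The definition of lower semicontinuity uses the punctured filter \<open>at x\<close>; since \<open>c < f x\<close> is
  itself available, the bound extends to a full neighbourhood.\<close>

lemma lsc_fun_eventually_nhds:
  assumes "lsc_fun f" and "c < f x"
  shows "\<forall>\<^sub>F y in nhds x. c < f y"
proof -
  have "c < Liminf (at x) f" using assms by (auto simp: lsc_fun_def intro: less_le_trans)
  then have "\<forall>\<^sub>F y in at x. c < f y" by (rule less_LiminfD)
  then show ?thesis
    unfolding eventually_at_filter by (rule eventually_mono) (use assms(2) in auto)
qed

lemma norm_convex_combination:
  fixes a b :: "'a::real_inner"
  shows "(norm ((1 - t) *\<^sub>R a + t *\<^sub>R b))\<^sup>2
    = (1 - t) * (norm a)\<^sup>2 + t * (norm b)\<^sup>2 - t * (1 - t) * (norm (a - b))\<^sup>2"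
  unfolding power2_norm_eq_inner
  by (simp add: inner_commute algebra_simps)

lemma convex_fun_finite:
  assumes cv: "convex_fun \<Psi>" and pr: "proper_fun \<Psi>"
    and x: "\<Psi> x = ereal a" and y: "\<Psi> y = ereal b" and t: "0 \<le> t" "t \<le> 1"
  obtains c where "\<Psi> ((1 - t) *\<^sub>R x + t *\<^sub>R y) = ereal c" and "c \<le> (1 - t) * a + t * b"
proof -
  have "\<Psi> ((1 - t) *\<^sub>R x + t *\<^sub>R y) \<le> ereal (1 - t) * \<Psi> x + ereal t * \<Psi> y"
    using cv t unfolding convex_fun_def by simp
  then have "\<Psi> ((1 - t) *\<^sub>R x + t *\<^sub>R y) \<le> ereal ((1 - t) * a + t * b)" by (simp add: x y)
  moreover have "\<Psi> ((1 - t) *\<^sub>R x + t *\<^sub>R y) \<noteq> -\<infinity>" using pr by (auto simp: proper_fun_def)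
  ultimately show thesis using that by (cases "\<Psi> ((1 - t) *\<^sub>R x + t *\<^sub>R y)") auto
qed

text \<open>Fermat's rule for a smooth plus a convex function. By convexity of \<open>\<Psi>\<close>, the function
  \<open>h t = \<Phi> (z + t (\<xi> - z)) + t (\<Psi> \<xi> - \<Psi> z)\<close> is, up to a constant, an upper bound for \<open>\<Phi> + \<Psi>\<close> on
  the segment from \<open>z\<close> to \<open>\<xi>\<close> that is exact at \<open>z\<close>. So \<open>h\<close> is minimal at 0 among nonnegative arguments below 1, and its derivative there
  is nonnegative, which is the claim.\<close>

lemma minimizer_affine_minorant:
  fixes \<Phi> :: "'a::real_inner \<Rightarrow> real"
  assumes cv: "convex_fun \<Psi>" and pr: "proper_fun \<Psi>"
    and grad: "GDERIV \<Phi> z :> g"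
    and min: "\<And>\<xi>. sum_fun \<Phi> \<Psi> z \<le> sum_fun \<Phi> \<Psi> \<xi>"
    and z: "\<Psi> z = ereal a"
  shows "ereal (a - g \<bullet> (\<xi> - z)) \<le> \<Psi> \<xi>"
proof (cases "\<Psi> \<xi>")
  case (real b)
  define h where "h t = \<Phi> (z + t *\<^sub>R (\<xi> - z)) + t * (b - a)" for t
  have "(h has_real_derivative g \<bullet> (\<xi> - z) + (b - a)) (at 0)"
    unfolding h_def
  proof (rule DERIV_add)
    show "((\<lambda>t. \<Phi> (z + t *\<^sub>R (\<xi> - z))) has_real_derivative g \<bullet> (\<xi> - z)) (at 0)"
      by (rule GDERIV_along_line) (simp add: grad)
  qed (auto intro!: derivative_eq_intros)
  moreover have "h 0 \<le> h t" if t: "0 < t" "t < 1" for t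
  proof -
    obtain c where c: "\<Psi> ((1 - t) *\<^sub>R z + t *\<^sub>R \<xi>) = ereal c" "c \<le> (1 - t) * a + t * b"
      using convex_fun_finite[OF cv pr z real, of t] t by auto
    have "(1 - t) *\<^sub>R z + t *\<^sub>R \<xi> = z + t *\<^sub>R (\<xi> - z)" by (simp add: algebra_simps)
    then show ?thesis
      using min[of "z + t *\<^sub>R (\<xi> - z)"] c z by (simp add: sum_fun_def h_def algebra_simps)
  qed
  ultimately have "0 \<le> g \<bullet> (\<xi> - z) + (b - a)"
    using DERIV_neg_dec_right[of h "g \<bullet> (\<xi> - z) + (b - a)" 0]
    by (metis add_0 dense_le_bounded field_lbound_gt_zero linorder_not_less zero_less_one)
  then show ?thesis using real by simp
next
  case MInf
  then show ?thesis using pr by (auto simp: proper_fun_def)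
qed simp

section \<open>The proximal operator\<close>

text \<open>Strong convexity of \<open>\<lambda>\<xi>. \<Psi> \<xi> + \<kappa> \<parallel>\<xi> - x\<parallel>\<^sup>2\<close> combined with a lower bound \<open>I\<close> for its values.
  If \<open>u\<close> and \<open>v\<close> almost attain \<open>I\<close>, the case \<open>t = 1 / 2\<close> forces them to be close to each other; if \<open>u\<close>
  attains \<open>I\<close>, letting \<open>t\<close> tend to 0 shows quadratic growth away from \<open>u\<close>.\<close>

lemma convex_quadratic_growth:
  fixes x :: "'a::real_inner"
  assumes cv: "convex_fun \<Psi>" and pr: "proper_fun \<Psi>"
    and a: "\<Psi> u = ereal a" and b: "\<Psi> v = ereal b"
    and low: "\<And>\<xi> c. \<Psi> \<xi> = ereal c \<Longrightarrow> I \<le> c + \<kappa> * (norm (\<xi> - x))\<^sup>2"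
    and t: "0 \<le> t" "t \<le> 1"
  shows "I + \<kappa> * (t * (1 - t) * (norm (u - v))\<^sup>2)
    \<le> (1 - t) * (a + \<kappa> * (norm (u - x))\<^sup>2) + t * (b + \<kappa> * (norm (v - x))\<^sup>2)"
proof -
  obtain c where c: "\<Psi> ((1 - t) *\<^sub>R u + t *\<^sub>R v) = ereal c" "c \<le> (1 - t) * a + t * b"
    using convex_fun_finite[OF cv pr a b t] .
  have "(1 - t) *\<^sub>R u + t *\<^sub>R v - x = (1 - t) *\<^sub>R (u - x) + t *\<^sub>R (v - x)"
    by (simp add: algebra_simps)
  then have "(norm ((1 - t) *\<^sub>R u + t *\<^sub>R v - x))\<^sup>2
      = (1 - t) * (norm (u - x))\<^sup>2 + t * (norm (v - x))\<^sup>2 - t * (1 - t) * (norm (u - v))\<^sup>2"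
    using norm_convex_combination[of t "u - x" "v - x"] by simp
  with low[OF c(1)]
  have "I \<le> c + \<kappa> * ((1 - t) * (norm (u - x))\<^sup>2 + t * (norm (v - x))\<^sup>2
      - t * (1 - t) * (norm (u - v))\<^sup>2)" by simp
  with c(2) show ?thesis by (simp add: algebra_simps)
qed

text \<open>The affine minorant bounds the objective below, and any sequence of points whose values approach
  the infimum is Cauchy by strong convexity. The norm term is continuous and \<open>\<Psi>\<close> is lower
  semicontinuous, so the infimum is attained at the limit.\<close>

lemma prox_objective_has_minimizer:
  fixes \<Psi> :: "'a::{real_inner, complete_space} \<Rightarrow> ereal"
  assumes cv: "convex_fun \<Psi>" and pr: "proper_fun \<Psi>" and lsc: "lsc_fun \<Psi>"
    and \<gamma>: "0 < \<gamma>"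
    and minorant: "\<And>\<xi>. ereal (m + g \<bullet> \<xi>) \<le> \<Psi> \<xi>"
  shows "\<exists>p. is_arg_min (\<lambda>\<xi>. \<Psi> \<xi> + ereal (1 / (2 * \<gamma>) * (norm (\<xi> - x))\<^sup>2)) (\<lambda>_. True) p"
proof -
  define \<kappa> where "\<kappa> = 1 / (2 * \<gamma>)"
  have \<kappa>: "\<kappa> > 0" using \<gamma> by (simp add: \<kappa>_def)
  define S where "S = {c + \<kappa> * (norm (\<xi> - x))\<^sup>2 | \<xi> c. \<Psi> \<xi> = ereal c}"
  define I where "I = Inf S"
  have "S \<noteq> {}"
  proof -
    obtain \<xi> where "\<Psi> \<xi> \<noteq> \<infinity>" "\<Psi> \<xi> \<noteq> -\<infinity>" using pr by (auto simp: proper_fun_def)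
    then show ?thesis by (cases "\<Psi> \<xi>") (auto simp: S_def)
  qed
  \<comment> \<open>The minimum over \<open>\<xi>\<close> of the minorant plus the quadratic term, attained at \<open>x - \<gamma> g\<close>.\<close>
  have "m + g \<bullet> x - \<gamma> / 2 * (norm g)\<^sup>2 \<le> w" if wS: "w \<in> S" for w
  proof -
    obtain \<xi> c where w: "w = c + \<kappa> * (norm (\<xi> - x))\<^sup>2" and c: "\<Psi> \<xi> = ereal c"
      using wS unfolding S_def by blast
    have "m + g \<bullet> \<xi> \<le> c" using minorant[of \<xi>] c by simp
    moreover have "0 \<le> \<kappa> * (norm ((\<xi> - x) + \<gamma> *\<^sub>R g))\<^sup>2" using \<kappa> by simp
    moreover have "\<kappa> * (norm ((\<xi> - x) + \<gamma> *\<^sub>R g))\<^sup>2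
        = \<kappa> * (norm (\<xi> - x))\<^sup>2 + (g \<bullet> \<xi> - g \<bullet> x) + \<gamma> / 2 * (norm g)\<^sup>2"
      unfolding power2_norm_eq_inner \<kappa>_def using \<gamma>
      by (simp add: inner_simps inner_commute field_simps)
    ultimately show ?thesis by (simp add: w)
  qed
  then have bdd: "bdd_below S" by (rule bdd_belowI)
  have low: "I \<le> c + \<kappa> * (norm (\<xi> - x))\<^sup>2" if "\<Psi> \<xi> = ereal c" for \<xi> c
    unfolding I_def using that by (intro cInf_lower bdd) (auto simp: S_def)
  have "\<exists>\<xi> c. \<Psi> \<xi> = ereal c \<and> c + \<kappa> * (norm (\<xi> - x))\<^sup>2 < I + 1 / real (Suc n)" for n
  proof -
    have "\<exists>w\<in>S. w < I + 1 / real (Suc n)"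
      using cInf_lessD[OF \<open>S \<noteq> {}\<close>, of "I + 1 / real (Suc n)"] by (simp add: I_def)
    then show ?thesis by (auto simp: S_def)
  qed
  then obtain \<xi> c where \<xi>: "\<And>n. \<Psi> (\<xi> n) = ereal (c n)"
      and near: "\<And>n. c n + \<kappa> * (norm (\<xi> n - x))\<^sup>2 < I + 1 / real (Suc n)"
    by metis
  have close: "\<kappa> / 4 * (norm (\<xi> i - \<xi> j))\<^sup>2 < 1 / real (Suc n)" if "n \<le> i" "n \<le> j" for n i j
  proof -
    have near': "c i + \<kappa> * (norm (\<xi> i - x))\<^sup>2 < I + 1 / real (Suc n)" if "n \<le> i" for i
    proof -
      have "1 / real (Suc i) \<le> 1 / real (Suc n)" using that by (simp add: frac_le)
      with near[of i] show ?thesis by linarith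
    qed
    from convex_quadratic_growth[OF cv pr \<xi>[of i] \<xi>[of j] low, of "1 / 2"]
    have "I + \<kappa> / 4 * (norm (\<xi> i - \<xi> j))\<^sup>2
        \<le> (c i + \<kappa> * (norm (\<xi> i - x))\<^sup>2) / 2 + (c j + \<kappa> * (norm (\<xi> j - x))\<^sup>2) / 2"
      by simp
    also have "\<dots> < (I + 1 / real (Suc n)) / 2 + (I + 1 / real (Suc n)) / 2"
      by (intro add_strict_mono divide_strict_right_mono near' that) auto
    also have "\<dots> = I + 1 / real (Suc n)" by (rule field_sum_of_halves)
    finally show ?thesis by simp
  qed
  have "Cauchy \<xi>"
  proof (rule CauchyI)
    fix \<epsilon> :: real assume \<epsilon>: "0 < \<epsilon>"
    obtain n where n: "1 / real (Suc n) < \<kappa> / 4 * \<epsilon>\<^sup>2"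
      using reals_Archimedean[of "\<kappa> / 4 * \<epsilon>\<^sup>2"] \<kappa> \<epsilon> by (auto simp: inverse_eq_divide)
    have "norm (\<xi> i - \<xi> j) < \<epsilon>" if "n \<le> i" "n \<le> j" for i j
    proof -
      have "\<kappa> / 4 * (norm (\<xi> i - \<xi> j))\<^sup>2 < \<kappa> / 4 * \<epsilon>\<^sup>2" using close[OF that] n by linarith
      then have "(norm (\<xi> i - \<xi> j))\<^sup>2 < \<epsilon>\<^sup>2" using \<kappa> by simp
      then show ?thesis using \<epsilon> by (simp add: power2_less_imp_less)
    qed
    then show "\<exists>M. \<forall>i\<ge>M. \<forall>j\<ge>M. norm (\<xi> i - \<xi> j) < \<epsilon>" by blast
  qed
  then obtain p where p: "\<xi> \<longlonglongrightarrow> p" using Cauchy_convergent_iff convergent_def by blast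
  have attained: "\<Psi> p \<le> ereal (I - \<kappa> * (norm (p - x))\<^sup>2)"
  proof (rule ccontr)
    assume "\<not> ?thesis"
    then have "ereal (I - \<kappa> * (norm (p - x))\<^sup>2) < \<Psi> p" by (simp only: not_le)
    then obtain d where d: "I - \<kappa> * (norm (p - x))\<^sup>2 < d" "ereal d < \<Psi> p"
      using ereal_dense2[of "ereal (I - \<kappa> * (norm (p - x))\<^sup>2)" "\<Psi> p"] by auto
    have "\<forall>\<^sub>F n in sequentially. ereal d < \<Psi> (\<xi> n)"
      using lsc_fun_eventually_nhds[OF lsc d(2)] p
      unfolding filterlim_iff by blast
    then have "\<forall>\<^sub>F n in sequentially. d + \<kappa> * (norm (\<xi> n - x))\<^sup>2 \<le> I + 1 / real (Suc n)"
    proof eventually_elim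
      case (elim n)
      then show ?case using near[of n] \<xi>[of n] by simp
    qed
    moreover have "(\<lambda>n. d + \<kappa> * (norm (\<xi> n - x))\<^sup>2) \<longlonglongrightarrow> d + \<kappa> * (norm (p - x))\<^sup>2"
      by (intro tendsto_intros p)
    moreover have "(\<lambda>n. I + 1 / real (Suc n)) \<longlonglongrightarrow> I + 0"
      by (intro tendsto_intros LIMSEQ_Suc[OF lim_1_over_n])
    ultimately have "d + \<kappa> * (norm (p - x))\<^sup>2 \<le> I + 0"
      using tendsto_le trivial_limit_sequentially by blast
    with d(1) show False by simp
  qed
  have "\<Psi> p + ereal (\<kappa> * (norm (p - x))\<^sup>2) \<le> \<Psi> \<eta> + ereal (\<kappa> * (norm (\<eta> - x))\<^sup>2)" for \<eta>
  proof (cases "\<Psi> \<eta>")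
    case (real b)
    then show ?thesis using attained low[OF real] by (cases "\<Psi> p") auto
  next
    case MInf
    then show ?thesis using pr by (auto simp: proper_fun_def)
  qed simp
  then show ?thesis unfolding is_arg_min_linorder \<kappa>_def by auto
qed

text \<open>Minimality of the proximal point gains the extra term \<open>\<parallel>prox \<gamma> \<Psi> x - \<xi>\<parallel>\<^sup>2\<close> by strong
  convexity.\<close>

lemma prox_three_point:
  fixes \<Psi> :: "'a::real_inner \<Rightarrow> ereal"
  assumes cv: "convex_fun \<Psi>" and pr: "proper_fun \<Psi>"
    and ex: "\<exists>p. is_arg_min (\<lambda>\<xi>. \<Psi> \<xi> + ereal (1 / (2 * \<gamma>) * (norm (\<xi> - x))\<^sup>2)) (\<lambda>_. True) p"
    and b: "\<Psi> \<xi> = ereal b"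
  obtains a where "\<Psi> (prox \<gamma> \<Psi> x) = ereal a"
    and "a + 1 / (2 * \<gamma>) * ((norm (prox \<gamma> \<Psi> x - x))\<^sup>2 + (norm (prox \<gamma> \<Psi> x - \<xi>))\<^sup>2)
      \<le> b + 1 / (2 * \<gamma>) * (norm (\<xi> - x))\<^sup>2"
proof -
  define p where "p = prox \<gamma> \<Psi> x"
  define \<kappa> where "\<kappa> = 1 / (2 * \<gamma>)"
  have "is_arg_min (\<lambda>\<xi>. \<Psi> \<xi> + ereal (\<kappa> * (norm (\<xi> - x))\<^sup>2)) (\<lambda>_. True) p"
    unfolding p_def prox_def arg_min_def \<kappa>_def by (rule someI_ex[OF ex])
  then have min: "\<Psi> p + ereal (\<kappa> * (norm (p - x))\<^sup>2) \<le> \<Psi> \<eta> + ereal (\<kappa> * (norm (\<eta> - x))\<^sup>2)" for \<eta>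
    by (simp add: is_arg_min_linorder)
  have "\<Psi> p \<noteq> \<infinity>" "\<Psi> p \<noteq> -\<infinity>" using min[of \<xi>] b pr by (auto simp: proper_fun_def)
  then obtain a where a: "\<Psi> p = ereal a" by (cases "\<Psi> p") auto
  have low: "a + \<kappa> * (norm (p - x))\<^sup>2 \<le> c + \<kappa> * (norm (\<eta> - x))\<^sup>2" if "\<Psi> \<eta> = ereal c" for \<eta> c
    using min[of \<eta>] a that by simp
  let ?A = "\<kappa> * (norm (p - \<xi>))\<^sup>2" and ?B = "b + \<kappa> * (norm (\<xi> - x))\<^sup>2 - (a + \<kappa> * (norm (p - x))\<^sup>2)"
  have "(1 - t) * ?A \<le> ?B" if t: "0 < t" "t < 1" for t
  proof -
    have "t * ((1 - t) * ?A) \<le> t * ?B"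
      using convex_quadratic_growth[OF cv pr a b low, of t] t by (simp add: algebra_simps)
    then show ?thesis using t by simp
  qed
  then have "\<forall>\<^sub>F t in at_right 0. (1 - t) * ?A \<le> ?B"
    by (intro eventually_at_rightI[of 0 1]) auto
  moreover have "((\<lambda>t::real. (1 - t) * ?A) \<longlongrightarrow> (1 - 0) * ?A) (at_right 0)"
    by (intro tendsto_intros)
  ultimately have "(1 - 0) * ?A \<le> ?B"
    by (intro tendsto_upperbound[of _ _ "at_right (0::real)"]) auto
  then show thesis
    using that a unfolding p_def \<kappa>_def by (simp add: algebra_simps)
qed

section \<open>The forward-backward step\<close>

text \<open>The three-point inequality of the backward step, the descent lemma for \<open>\<Phi>\<close> between \<open>y\<close> and \<open>T\<close>,
  and the gradient inequality for \<open>\<Phi>\<close> between \<open>y\<close> and \<open>v\<close> add up: all terms with \<open>g y\<close> cancel, and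
  \<open>s L \<le> 1\<close> lets \<open>\<parallel>T - y\<parallel>\<^sup>2\<close> absorb the error of the descent lemma.\<close>

lemma forward_backward_descent:
  fixes \<Phi> :: "'a::real_inner \<Rightarrow> real"
  assumes cv\<Phi>: "convex_on UNIV \<Phi>" and grad: "\<And>z. GDERIV \<Phi> z :> g z"
    and lip: "L-lipschitz_on UNIV g" and L: "0 < L"
    and cv: "convex_fun \<Psi>" and pr: "proper_fun \<Psi>"
    and ex: "\<And>x. \<exists>p. is_arg_min (\<lambda>\<xi>. \<Psi> \<xi> + ereal (1 / (2 * s) * (norm (\<xi> - x))\<^sup>2)) (\<lambda>_. True) p"
    and s: "0 < s" "s \<le> 1 / L"
    and T: "T = prox s \<Psi> (y - s *\<^sub>R g y)"
    and b: "\<Psi> v = ereal b"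
  obtains a where "\<Psi> T = ereal a"
    and "2 * s * (\<Phi> T + a) \<le> 2 * s * (\<Phi> v + b) + (norm (y - v))\<^sup>2 - (norm (T - v))\<^sup>2"
proof -
  obtain a where a: "\<Psi> T = ereal a"
    and prox: "a + 1 / (2 * s) * ((norm (T - (y - s *\<^sub>R g y)))\<^sup>2 + (norm (T - v))\<^sup>2)
      \<le> b + 1 / (2 * s) * (norm (v - (y - s *\<^sub>R g y)))\<^sup>2"
    unfolding T by (rule prox_three_point[OF cv pr ex b])
  have expand: "(norm (u - (y - s *\<^sub>R g y)))\<^sup>2
      = (norm (u - y))\<^sup>2 + 2 * s * (g y \<bullet> (u - y)) + s\<^sup>2 * (norm (g y))\<^sup>2" for u
    unfolding power2_norm_eq_inner
    by (simp add: inner_commute algebra_simps power2_eq_square)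
  have "2 * s * a + (norm (T - (y - s *\<^sub>R g y)))\<^sup>2 + (norm (T - v))\<^sup>2
      \<le> 2 * s * b + (norm (v - (y - s *\<^sub>R g y)))\<^sup>2"
    using mult_left_mono[OF prox, of "2 * s"] s by (simp add: algebra_simps)
  then have 1: "2 * s * a + (norm (T - y))\<^sup>2 + 2 * s * (g y \<bullet> (T - y)) + (norm (T - v))\<^sup>2
      \<le> 2 * s * b + (norm (y - v))\<^sup>2 + 2 * s * (g y \<bullet> (v - y))"
    unfolding expand by (simp add: norm_minus_commute)
  have "s * L \<le> 1" using s L by (simp add: field_simps)
  then have "s * L * (norm (T - y))\<^sup>2 \<le> (norm (T - y))\<^sup>2"
    by (simp add: mult_left_le_one_le s(1) L less_imp_le)
  moreover have "2 * s * \<Phi> T \<le> 2 * s * \<Phi> y + 2 * s * (g y \<bullet> (T - y)) + s * L * (norm (T - y))\<^sup>2"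
    using mult_left_mono[OF descent_lemma[OF grad lip, of T y], of "2 * s"] s
    by (simp add: algebra_simps)
  moreover have "2 * s * \<Phi> y + 2 * s * (g y \<bullet> (v - y)) \<le> 2 * s * \<Phi> v"
    using mult_left_mono[OF convex_on_GDERIV_lower[OF cv\<Phi> grad, of y v], of "2 * s"] s
    by (simp add: algebra_simps)
  ultimately have "2 * s * (\<Phi> T + a) \<le> 2 * s * (\<Phi> v + b) + (norm (y - v))\<^sup>2 - (norm (T - v))\<^sup>2"
    using 1 by (simp add: algebra_simps)
  with a that show thesis by blast
qed

text \<open>The weights \<open>k (k - c)\<close> and \<open>k c\<close> sum to \<open>k\<^sup>2\<close>. For each point \<open>v\<close> the weighted sum of its squared
  distances to \<open>x\<close> and \<open>z\<close> is the squared distance of \<open>k v\<close> to \<open>(k - c) x + c z\<close>, up to a term that is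
  independent of \<open>v\<close> and cancels between \<open>v = y\<close> and \<open>v = x'\<close>.\<close>

lemma weighted_descent:
  fixes x x' y z :: "'a::real_inner"
  assumes y: "y = x + (1 - \<alpha> / k) *\<^sub>R (x - u)" and k: "0 < k" "0 \<le> c" "c \<le> k"
    and at_x: "\<tau> * \<theta>' \<le> \<tau> * \<theta> + (norm (y - x))\<^sup>2 - (norm (x' - x))\<^sup>2"
    and at_z: "\<tau> * \<theta>' \<le> (norm (y - z))\<^sup>2 - (norm (x' - z))\<^sup>2"
  shows "\<tau> * (k\<^sup>2 * \<theta>' - k * (k - c) * \<theta>)
    \<le> (norm (c *\<^sub>R (x - z) + (k - \<alpha>) *\<^sub>R (x - u)))\<^sup>2
      - (norm (c *\<^sub>R (x' - z) + (k - c) *\<^sub>R (x' - x)))\<^sup>2"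
proof -
  have combine: "k * (k - c) * (norm (v - x))\<^sup>2 + k * c * (norm (v - z))\<^sup>2
      = (norm (c *\<^sub>R (v - z) + (k - c) *\<^sub>R (v - x)))\<^sup>2 + c * (k - c) * (norm (x - z))\<^sup>2" for v
    unfolding power2_norm_eq_inner
    by (simp add: inner_commute algebra_simps power2_eq_square)
  have "k * (1 - \<alpha> / k) = k - \<alpha>" using k by (simp add: field_simps)
  then have "k *\<^sub>R (y - x) = (k - \<alpha>) *\<^sub>R (x - u)" by (simp add: y)
  then have y': "c *\<^sub>R (y - z) + (k - c) *\<^sub>R (y - x) = c *\<^sub>R (x - z) + (k - \<alpha>) *\<^sub>R (x - u)"
    by (simp add: algebra_simps)
  have "k * (k - c) * (\<tau> * \<theta>') + k * c * (\<tau> * \<theta>')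
      \<le> k * (k - c) * (\<tau> * \<theta> + (norm (y - x))\<^sup>2 - (norm (x' - x))\<^sup>2)
        + k * c * ((norm (y - z))\<^sup>2 - (norm (x' - z))\<^sup>2)"
    using k at_x at_z by (intro add_mono mult_left_mono) auto
  then show ?thesis using combine[of y] combine[of x'] unfolding y'
    by (simp add: algebra_simps power2_eq_square)
qed

section \<open>Asymptotics of the energy\<close>

text \<open>Completing the square: \<open>P\<close> times the form is at least \<open>\<parallel>P X + Q d\<parallel>\<^sup>2\<close>.\<close>

lemma quad_form_nonpos:
  fixes X d :: "'a::real_inner"
  assumes "P < 0" and "Q\<^sup>2 \<le> P * R"
  shows "P * (norm X)\<^sup>2 + 2 * Q * (X \<bullet> d) + R * (norm d)\<^sup>2 \<le> 0"
proof -
  have "0 \<le> (norm (P *\<^sub>R X + Q *\<^sub>R d))\<^sup>2" by simp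
  also have "\<dots> = P * (P * (norm X)\<^sup>2 + 2 * Q * (X \<bullet> d)) + Q\<^sup>2 * (norm d)\<^sup>2"
    unfolding power2_norm_eq_inner
    by (simp add: inner_commute algebra_simps power2_eq_square)
  also have "Q\<^sup>2 * (norm d)\<^sup>2 \<le> P * R * (norm d)\<^sup>2"
    using assms(2) by (rule mult_right_mono) simp
  finally have "0 \<le> P * (P * (norm X)\<^sup>2 + 2 * Q * (X \<bullet> d) + R * (norm d)\<^sup>2)"
    by (simp add: algebra_simps)
  then show ?thesis using assms(1) by (simp add: zero_le_mult_iff)
qed

text \<open>Here \<open>\<rho> k\<close> is the ratio of the weights at \<open>k - 1\<close> and \<open>k\<close>, so that \<open>\<rho> k = 1 + (2 - \<beta>) / k\<close> to
  first order, and this is all that matters about the weight. Collecting terms, the difference of the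
  two sides is the quadratic form with coefficients \<open>P\<close>, \<open>Q\<close>, \<open>R\<close>. In the limit, \<open>k P\<close> tends to
  \<open>-(c\<^sup>2 + e) (2 - \<beta>) < 0\<close>, \<open>R / k\<close> tends to \<open>2 c - 2 \<alpha> + \<beta> < 0\<close>, and \<open>Q\<close> tends to
  \<open>e - c (\<alpha> + 1 - \<beta> - c) = 0\<close>. Therefore \<open>Q\<^sup>2 - P R\<close> has a negative limit.\<close>

lemma eventually_dissipative:
  fixes \<rho> :: "nat \<Rightarrow> real"
  assumes lim: "(\<lambda>k. real k * (\<rho> k - 1)) \<longlonglongrightarrow> 2 - \<beta>"
    and \<beta>: "0 < \<beta>" "\<beta> < 2" and c: "\<beta> < c" "c < \<alpha> - \<beta> / 2"
    and e: "e = c * (\<alpha> + 1 - \<beta> - c)"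
  shows "\<forall>\<^sub>F k in sequentially. \<forall>X d :: 'a::real_inner.
      (norm (c *\<^sub>R X + (real k - \<alpha>) *\<^sub>R d))\<^sup>2 + e * (norm X)\<^sup>2
        \<le> \<rho> k * ((norm (c *\<^sub>R X + (real k - 1 - c) *\<^sub>R d))\<^sup>2 + e * (norm (X - d))\<^sup>2)"
proof -
  define \<sigma> where "\<sigma> k = real k * (\<rho> k - 1)" for k
  define \<iota> where "\<iota> k = 1 / real k" for k
  define P where "P k = - (c\<^sup>2 + e) * (\<rho> k - 1)" for k
  define Q where "Q k = c * ((real k - \<alpha>) - \<rho> k * (real k - 1 - c)) + e * \<rho> k" for k
  define R where "R k = (real k - \<alpha>)\<^sup>2 - \<rho> k * (real k - 1 - c)\<^sup>2 - e * \<rho> k" for k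
  have \<sigma>: "\<sigma> \<longlonglongrightarrow> 2 - \<beta>" using lim by (simp add: \<sigma>_def[abs_def])
  have \<iota>: "\<iota> \<longlonglongrightarrow> 0" unfolding \<iota>_def[abs_def] by (rule lim_1_over_n)
  have "e > 0" using \<beta> c by (simp add: e)
  then have "0 < c\<^sup>2 + e" by (intro add_nonneg_pos) simp_all
  then have neg: "- (c\<^sup>2 + e) * (2 - \<beta>) < 0"
    using \<beta> by (intro mult_neg_pos) linarith+
  have neg': "2 * (1 + c - \<alpha>) - (2 - \<beta>) < 0" using c by simp
  \<comment> \<open>The rescaled coefficients as polynomials in \<open>\<sigma>\<close> and \<open>\<iota>\<close>, whose limits are known.\<close>
  let ?P = "\<lambda>k. - (c\<^sup>2 + e) * \<sigma> k"
  let ?Q = "\<lambda>k. c * (1 + c - \<alpha> - \<sigma> k + (1 + c) * (\<sigma> k * \<iota> k)) + e * (1 + \<sigma> k * \<iota> k)"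
  let ?R = "\<lambda>k. 2 * (1 + c - \<alpha>) + (\<alpha>\<^sup>2 - (1 + c)\<^sup>2) * \<iota> k
        - \<sigma> k * (1 - (1 + c) * \<iota> k)\<^sup>2 - e * (1 + \<sigma> k * \<iota> k) * \<iota> k"
  have forms: "real k * P k = ?P k"
    "Q k = ?Q k"
    "R k / real k = ?R k"
    if "k > 0" for k
  proof -
    have \<sigma>\<iota>: "\<sigma> k * \<iota> k = \<rho> k - 1" and "real k * \<iota> k = 1"
      using that by (simp_all add: \<sigma>_def \<iota>_def)
    then have shift: "real k * (1 - (1 + c) * \<iota> k) = real k - 1 - c"
      by (simp add: algebra_simps)
    show "real k * P k = ?P k"
      by (simp add: P_def \<sigma>_def)
    show "Q k = ?Q k"
      unfolding \<sigma>\<iota> by (simp add: Q_def \<sigma>_def algebra_simps)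
    have "real k * (\<sigma> k * (1 - (1 + c) * \<iota> k)\<^sup>2)
        = (\<rho> k - 1) * (real k * (1 - (1 + c) * \<iota> k))\<^sup>2"
      by (simp only: \<sigma>_def power2_eq_square mult_ac)
    then have "real k * (\<sigma> k * (1 - (1 + c) * \<iota> k)\<^sup>2) = (\<rho> k - 1) * (real k - 1 - c)\<^sup>2"
      unfolding shift .
    moreover have "real k * ((\<alpha>\<^sup>2 - (1 + c)\<^sup>2) * \<iota> k) = \<alpha>\<^sup>2 - (1 + c)\<^sup>2"
      "real k * (e * (1 + \<sigma> k * \<iota> k) * \<iota> k) = e * \<rho> k"
      using \<open>real k * \<iota> k = 1\<close> unfolding \<sigma>\<iota> by (simp_all add: mult.left_commute)
    ultimately have "R k = real k * ?R k"
      unfolding right_diff_distrib distrib_left[of "real k"]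
      by (simp add: R_def algebra_simps power2_eq_square)
    then show "R k / real k = ?R k"
      using that by simp
  qed
  have P: "?P \<longlonglongrightarrow> - (c\<^sup>2 + e) * (2 - \<beta>)"
    by (intro tendsto_intros \<sigma>)
  have "?Q
      \<longlonglongrightarrow> c * (1 + c - \<alpha> - (2 - \<beta>) + (1 + c) * ((2 - \<beta>) * 0)) + e * (1 + (2 - \<beta>) * 0)"
    by (intro tendsto_intros \<sigma> \<iota>)
  moreover have "c * (1 + c - \<alpha> - (2 - \<beta>) + (1 + c) * ((2 - \<beta>) * 0)) + e * (1 + (2 - \<beta>) * 0) = 0"
    by (simp add: e algebra_simps)
  ultimately have Q: "?Q \<longlonglongrightarrow> 0" by (simp only:)
  have "?R
      \<longlonglongrightarrow> 2 * (1 + c - \<alpha>) + (\<alpha>\<^sup>2 - (1 + c)\<^sup>2) * 0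
        - (2 - \<beta>) * (1 - (1 + c) * 0)\<^sup>2 - e * (1 + (2 - \<beta>) * 0) * 0"
    by (intro tendsto_intros \<sigma> \<iota>)
  then have R: "?R
      \<longlonglongrightarrow> 2 * (1 + c - \<alpha>) - (2 - \<beta>)" by simp
  have "(\<lambda>k. (?Q k)\<^sup>2 - ?P k * ?R k) \<longlonglongrightarrow> 0\<^sup>2 - (- (c\<^sup>2 + e) * (2 - \<beta>)) * (2 * (1 + c - \<alpha>) - (2 - \<beta>))"
    by (intro tendsto_diff[OF tendsto_power[OF Q] tendsto_mult[OF P R]])
  then have "\<forall>\<^sub>F k in sequentially. (?Q k)\<^sup>2 - ?P k * ?R k < 0"
    by (rule order_tendstoD(2)) (use mult_neg_neg[OF neg neg'] in
      \<open>simp only: zero_power2 diff_0 neg_less_0_iff_less\<close>)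
  moreover have "\<forall>\<^sub>F k in sequentially. ?P k < 0"
    by (rule order_tendstoD(2)[OF P neg])
  ultimately show ?thesis using eventually_gt_at_top[of 0]
  proof eventually_elim
    case (elim k)
    have PR: "P k < 0" "(Q k)\<^sup>2 \<le> P k * R k"
    proof -
      have "real k * P k < 0" using elim forms(1) by simp
      then show "P k < 0" using elim by (simp add: mult_less_0_iff)
      have "(Q k)\<^sup>2 \<le> (real k * P k) * (R k / real k)"
        using elim(1) unfolding forms[OF elim(3)] by simp
      then show "(Q k)\<^sup>2 \<le> P k * R k" using elim by simp
    qed
    show ?case
    proof (intro allI)
      fix X d :: 'a
      have "(norm (c *\<^sub>R X + (real k - \<alpha>) *\<^sub>R d))\<^sup>2 + e * (norm X)\<^sup>2
          - \<rho> k * ((norm (c *\<^sub>R X + (real k - 1 - c) *\<^sub>R d))\<^sup>2 + e * (norm (X - d))\<^sup>2)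
          = P k * (norm X)\<^sup>2 + 2 * Q k * (X \<bullet> d) + R k * (norm d)\<^sup>2"
        unfolding power2_norm_eq_inner P_def Q_def R_def
        by (simp add: inner_commute algebra_simps power2_eq_square)
      with quad_form_nonpos[OF PR, of X d]
      show "(norm (c *\<^sub>R X + (real k - \<alpha>) *\<^sub>R d))\<^sup>2 + e * (norm X)\<^sup>2
          \<le> \<rho> k * ((norm (c *\<^sub>R X + (real k - 1 - c) *\<^sub>R d))\<^sup>2 + e * (norm (X - d))\<^sup>2)" by simp
    qed
  qed
qed

text \<open>To first order the right-hand side is \<open>k\<^sup>2 - \<beta> k\<close>, so the gap is about \<open>(c - \<beta>) k\<close>. This lets
  the coefficient of \<open>\<theta> k\<close> in the weighted step inequality be replaced by the one in the energy.\<close>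

lemma eventually_value_weight:
  fixes \<rho> :: "nat \<Rightarrow> real"
  assumes lim: "(\<lambda>k. real k * (\<rho> k - 1)) \<longlonglongrightarrow> 2 - \<beta>" and c: "\<beta> < c"
  shows "\<forall>\<^sub>F k in sequentially. real k * (real k - c) \<le> \<rho> k * (real k - 1)\<^sup>2"
proof -
  define \<sigma> where "\<sigma> k = real k * (\<rho> k - 1)" for k
  define \<iota> where "\<iota> k = 1 / real k" for k
  have \<sigma>: "\<sigma> \<longlonglongrightarrow> 2 - \<beta>" using lim by (simp add: \<sigma>_def[abs_def])
  have \<iota>: "\<iota> \<longlonglongrightarrow> 0" unfolding \<iota>_def[abs_def] by (rule lim_1_over_n)
  have "(\<lambda>k. c - 2 + \<iota> k + \<sigma> k * (1 - \<iota> k)\<^sup>2) \<longlonglongrightarrow> c - 2 + 0 + (2 - \<beta>) * (1 - 0)\<^sup>2"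
    by (intro tendsto_intros \<sigma> \<iota>)
  then have "\<forall>\<^sub>F k in sequentially. 0 < c - 2 + \<iota> k + \<sigma> k * (1 - \<iota> k)\<^sup>2"
    by (rule order_tendstoD(1)) (use c in simp)
  then show ?thesis using eventually_gt_at_top[of 0]
  proof eventually_elim
    case (elim k)
    have "\<rho> k * (real k - 1)\<^sup>2 - real k * (real k - c)
        = real k * (c - 2 + \<iota> k + \<sigma> k * (1 - \<iota> k)\<^sup>2)"
      using elim(2) unfolding \<sigma>_def \<iota>_def by (simp add: field_simps power2_eq_square)
    moreover have "0 \<le> real k * (c - 2 + \<iota> k + \<sigma> k * (1 - \<iota> k)\<^sup>2)" using elim by simp
    ultimately show ?case by linarith
  qed
qed

text \<open>The energy \<open>F n\<close> contains \<open>\<parallel>x n - z\<parallel>\<^sup>2\<close> rather than \<open>\<parallel>x (n + 1) - z\<parallel>\<^sup>2\<close>: then the increment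
  from \<open>F (k - 1)\<close> to \<open>F k\<close>, after the step inequality has removed \<open>x (k + 1)\<close>, involves besides \<open>\<theta> k\<close> only
  \<open>x k - z\<close> and \<open>x k - x (k - 1)\<close>, since \<open>x (k - 1) - z\<close> is their difference.\<close>

lemma inertial_rate:
  fixes x :: "nat \<Rightarrow> 'a::real_inner" and \<theta> :: "nat \<Rightarrow> real"
  assumes \<beta>: "0 < \<beta>" "\<beta> < 2" and c: "\<beta> < c" "c < \<alpha> - \<beta> / 2" and \<tau>: "0 < \<tau>"
    and nonneg: "\<And>k. k \<ge> 2 \<Longrightarrow> 0 \<le> \<theta> k"
    and step: "\<And>k. k \<ge> 2 \<Longrightarrow> c \<le> real k \<Longrightarrow>
      \<tau> * ((real k)\<^sup>2 * \<theta> (Suc k) - real k * (real k - c) * \<theta> k)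
      \<le> (norm (c *\<^sub>R (x k - z) + (real k - \<alpha>) *\<^sub>R (x k - x (k - 1))))\<^sup>2
        - (norm (c *\<^sub>R (x (Suc k) - z) + (real k - c) *\<^sub>R (x (Suc k) - x k)))\<^sup>2"
  shows "\<theta> \<in> O(\<lambda>k. 1 / real k powr \<beta>)"
proof -
  define e where "e = c * (\<alpha> + 1 - \<beta> - c)"
  have e: "e > 0" using \<beta> c by (simp add: e_def)
  define w where "w n = real n powr (\<beta> - 2)" for n :: nat
  define \<rho> where "\<rho> k = (real k - 1) powr (\<beta> - 2) / real k powr (\<beta> - 2)" for k
  define F where "F n = w n * (\<tau> * ((real n)\<^sup>2 * \<theta> (Suc n))
      + (norm (c *\<^sub>R (x (Suc n) - z) + (real n - c) *\<^sub>R (x (Suc n) - x n)))\<^sup>2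
      + e * (norm (x n - z))\<^sup>2)" for n
  have lim: "(\<lambda>k. real k * (\<rho> k - 1)) \<longlonglongrightarrow> 2 - \<beta>"
    unfolding \<rho>_def by real_asymp
  have "\<forall>\<^sub>F k in sequentially. F k \<le> F (k - 1)"
    using eventually_dissipative[OF lim \<beta> c e_def, where ?'a = 'a]
      eventually_value_weight[OF lim c(1)] eventually_ge_at_top[of 2]
      eventually_ge_at_top[of "nat \<lceil>c\<rceil>"]
  proof eventually_elim
    case (elim k)
    let ?X = "x k - z" and ?d = "x k - x (k - 1)"
    have k: "k \<ge> 2" "c \<le> real k" "Suc (k - 1) = k" "real (k - 1) = real k - 1"
      using elim by (auto simp: of_nat_diff)
    have w: "w (k - 1) = w k * \<rho> k" using k by (simp add: w_def \<rho>_def)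
    have X: "x (k - 1) - z = ?X - ?d" by simp
    have "\<tau> * ((real k)\<^sup>2 * \<theta> (Suc k))
        + (norm (c *\<^sub>R (x (Suc k) - z) + (real k - c) *\<^sub>R (x (Suc k) - x k)))\<^sup>2 + e * (norm ?X)\<^sup>2
        \<le> \<tau> * (real k * (real k - c) * \<theta> k)
          + ((norm (c *\<^sub>R ?X + (real k - \<alpha>) *\<^sub>R ?d))\<^sup>2 + e * (norm ?X)\<^sup>2)"
      using step[OF k(1,2)] by (simp add: algebra_simps)
    also have "\<dots> \<le> \<tau> * (\<rho> k * (real k - 1)\<^sup>2 * \<theta> k)
          + \<rho> k * ((norm (c *\<^sub>R ?X + (real k - 1 - c) *\<^sub>R ?d))\<^sup>2 + e * (norm (?X - ?d))\<^sup>2)"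
      using \<tau>
      by (intro add_mono mult_left_mono mult_right_mono elim(1)[rule_format] elim(2) nonneg k) auto
    also have "\<dots> = \<rho> k * (\<tau> * ((real k - 1)\<^sup>2 * \<theta> k)
          + (norm (c *\<^sub>R ?X + (real k - 1 - c) *\<^sub>R ?d))\<^sup>2 + e * (norm (?X - ?d))\<^sup>2)"
      by (simp add: algebra_simps)
    finally show ?case
      unfolding F_def w k(3,4) X mult.assoc by (rule mult_left_mono) (simp add: w_def)
  qed
  then obtain K where K: "\<And>k. k \<ge> K \<Longrightarrow> F k \<le> F (k - 1)"
    by (auto simp: eventually_sequentially)
  define M where "M = max 0 (F K)"
  have M: "F k \<le> M" if "k \<ge> K" for k
    using that
  proof (induction k rule: dec_induct)
    case (step n)
    then show ?case using K[of "Suc n"] by simp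
  qed (simp add: M_def)
  have "\<forall>\<^sub>F k in sequentially. norm (\<theta> k) \<le> M / \<tau> * 2 powr \<beta> * norm (1 / real k powr \<beta>)"
    using eventually_ge_at_top[of "max 2 (Suc K)"]
  proof eventually_elim
    case (elim k)
    then have k: "k \<ge> 2" "K \<le> k - 1" "Suc (k - 1) = k" "0 < real (k - 1)" by auto
    have "w (k - 1) * (\<tau> * ((real (k - 1))\<^sup>2 * \<theta> k)) \<le> F (k - 1)"
      unfolding F_def k(3) using e by (intro mult_left_mono) (auto simp: w_def)
    also have "w (k - 1) * (\<tau> * ((real (k - 1))\<^sup>2 * \<theta> k)) = \<tau> * (real (k - 1) powr \<beta> * \<theta> k)"
    proof -
      have "w (k - 1) * (real (k - 1))\<^sup>2 = real (k - 1) powr \<beta>"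
        using k(4) by (simp add: w_def powr_numeral[symmetric] powr_add[symmetric] del: powr_numeral)
      then show ?thesis by (metis mult.assoc mult.left_commute)
    qed
    finally have 1: "real (k - 1) powr \<beta> * \<theta> k \<le> M / \<tau>"
      using M[OF k(2)] \<tau> by (simp add: field_simps)
    \<comment> \<open>The energy at \<open>k - 1\<close> controls \<open>\<theta> k\<close>; the shift of the index costs a factor \<open>2 powr \<beta>\<close>.\<close>
    have "real k powr \<beta> \<le> (2 * real (k - 1)) powr \<beta>"
      using k \<beta> by (intro powr_mono2) auto
    also have "\<dots> = 2 powr \<beta> * real (k - 1) powr \<beta>" using k by (subst powr_mult) auto
    finally have "real k powr \<beta> * \<theta> k \<le> 2 powr \<beta> * real (k - 1) powr \<beta> * \<theta> k"
      using nonneg[OF k(1)] by (rule mult_right_mono)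
    also have "\<dots> \<le> 2 powr \<beta> * (M / \<tau>)" 
      unfolding mult.assoc by (rule mult_left_mono[OF 1]) simp
    finally have "real k powr \<beta> * \<theta> k \<le> M / \<tau> * 2 powr \<beta>" by (simp add: mult.commute)
    then have "\<theta> k \<le> M / \<tau> * 2 powr \<beta> / real k powr \<beta>"
      using k(1) by (subst pos_le_divide_eq) (auto simp: mult.commute)
    then show ?case using nonneg[OF k(1)] by simp
  qed
  then show ?thesis by (rule bigoI)
qed

section \<open>Rate of convergence for \<open>\<alpha> \<le> 3\<close>\<close>

theorem theorem4p1:
  fixes \<Phi> :: "'a::{real_inner, complete_space} \<Rightarrow> real"
    and grad\<Phi> :: "'a \<Rightarrow> 'a"
    and \<Psi> :: "'a \<Rightarrow> ereal"
    and L s \<alpha> p :: real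
    and x y :: "nat \<Rightarrow> 'a"
  assumes "convex_on UNIV \<Phi>"
    and "\<And>z. GDERIV \<Phi> z :> grad\<Phi> z"
    and "L > 0" and "L-lipschitz_on UNIV grad\<Phi>"
    and "convex_fun \<Psi>" and "proper_fun \<Psi>" and "lsc_fun \<Psi>"
    and "\<exists>z. is_arg_min (sum_fun \<Phi> \<Psi>) (\<lambda>_. True) z"
    and "0 < s" and "s \<le> 1 / L"
    and "0 < \<alpha>" and "\<alpha> \<le> 3"
    and "\<And>k. k \<ge> 1 \<Longrightarrow> y k = x k + (1 - \<alpha> / real k) *\<^sub>R (x k - x (k - 1))"
    and "\<And>k. k \<ge> 1 \<Longrightarrow> x (k + 1) = prox s \<Psi> (y k - s *\<^sub>R grad\<Phi> (y k))"
    and "p < 2 * \<alpha> / 3"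
  shows "(\<forall>\<^sub>F k in sequentially. sum_fun \<Phi> \<Psi> (x k) \<noteq> \<infinity>) \<and>
    (\<lambda>k. real_of_ereal (sum_fun \<Phi> \<Psi> (x k) - (INF z. sum_fun \<Phi> \<Psi> z)))
      \<in> O(\<lambda>k. 1 / real k powr p)"
proof -
  note cv = \<open>convex_fun \<Psi>\<close> and pr = \<open>proper_fun \<Psi>\<close>
  obtain z where z: "\<And>\<xi>. sum_fun \<Phi> \<Psi> z \<le> sum_fun \<Phi> \<Psi> \<xi>"
    using assms(8) by (auto simp: is_arg_min_linorder)
  obtain \<xi>0 where "\<Psi> \<xi>0 \<noteq> \<infinity>" using pr by (auto simp: proper_fun_def)
  then have "\<Psi> z \<noteq> \<infinity>" using z[of \<xi>0] by (auto simp: sum_fun_def)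
  moreover have "\<Psi> z \<noteq> -\<infinity>" using pr by (auto simp: proper_fun_def)
  ultimately obtain b where b: "\<Psi> z = ereal b" by (cases "\<Psi> z") auto
  have minorant: "ereal ((b + grad\<Phi> z \<bullet> z) + (- grad\<Phi> z) \<bullet> \<xi>) \<le> \<Psi> \<xi>" for \<xi>
    using minimizer_affine_minorant[OF cv pr assms(2) z b, of \<xi>]
    by (simp add: inner_diff_right algebra_simps)
  have ex: "\<exists>q. is_arg_min (\<lambda>\<xi>. \<Psi> \<xi> + ereal (1 / (2 * s) * (norm (\<xi> - u))\<^sup>2)) (\<lambda>_. True) q" for u
    by (rule prox_objective_has_minimizer[OF cv pr \<open>lsc_fun \<Psi>\<close> \<open>0 < s\<close> minorant])
  define m where "m = \<Phi> z + b"
  have Inf: "(INF \<xi>. sum_fun \<Phi> \<Psi> \<xi>) = ereal m"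
  proof -
    have "(INF \<xi>. sum_fun \<Phi> \<Psi> \<xi>) = sum_fun \<Phi> \<Psi> z" by (intro INF_eqI) (auto intro: z)
    then show ?thesis by (simp add: sum_fun_def b m_def)
  qed
  define \<psi> where "\<psi> k = real_of_ereal (\<Psi> (x k))" for k
  define \<theta> where "\<theta> k = \<Phi> (x k) + \<psi> k - m" for k
  have descent: "\<exists>a. \<Psi> (x (Suc k)) = ereal a \<and> 2 * s * (\<Phi> (x (Suc k)) + a)
      \<le> 2 * s * (\<Phi> v + r) + (norm (y k - v))\<^sup>2 - (norm (x (Suc k) - v))\<^sup>2"
    if "k \<ge> 1" "\<Psi> v = ereal r" for k v r
  proof -
    have "x (Suc k) = prox s \<Psi> (y k - s *\<^sub>R grad\<Phi> (y k))" using assms(14)[OF that(1)] by simp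
    from forward_backward_descent[OF assms(1,2,4,3) cv pr ex assms(9,10) this that(2)]
    show ?thesis by metis
  qed
  \<comment> \<open>The initial points may lie outside the domain of \<open>\<Psi>\<close>; \<open>x 2\<close> is the first proximal point.\<close>
  have fin: "\<Psi> (x k) = ereal (\<psi> k)" if "k \<ge> 2" for k
  proof -
    have k: "k - 1 \<ge> 1" "Suc (k - 1) = k" using that by auto
    show ?thesis using descent[OF k(1) b] unfolding k(2) by (auto simp: \<psi>_def)
  qed
  have objective: "sum_fun \<Phi> \<Psi> (x k) = ereal (\<theta> k + m)" if "k \<ge> 2" for k
    by (simp add: sum_fun_def fin[OF that] \<theta>_def)
  have nonneg: "0 \<le> \<theta> k" if "k \<ge> 2" for k
    using z[of "x k"] unfolding objective[OF that] by (simp add: sum_fun_def b m_def)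

  \<comment> \<open>The maximum makes the exponent positive; \<open>c\<close> is the midpoint of the interval from
    \<open>\<beta>\<close> to \<open>\<alpha> - \<beta> / 2\<close>.\<close>
  define \<beta> where "\<beta> = max p (\<alpha> / 3)"
  define c where "c = \<alpha> / 2 + \<beta> / 4"
  have \<beta>: "0 < \<beta>" "\<beta> < 2 * \<alpha> / 3" "p \<le> \<beta>" "\<beta> < 2"
    using assms(11,12,15) by (auto simp: \<beta>_def)
  then have c: "\<beta> < c" "c < \<alpha> - \<beta> / 2" "0 \<le> c" by (auto simp: c_def)
  have "\<theta> \<in> O(\<lambda>k. 1 / real k powr \<beta>)"
  proof (rule inertial_rate[OF \<beta>(1,4) c(1,2), where \<tau> = "2 * s"])
    fix k :: nat assume k: "k \<ge> 2" "c \<le> real k"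
    have "2 * s * \<theta> (Suc k) \<le> 2 * s * \<theta> k + (norm (y k - x k))\<^sup>2 - (norm (x (Suc k) - x k))\<^sup>2"
      using descent[of k, OF _ fin[OF k(1)]] fin[of "Suc k"] k by (auto simp: \<theta>_def algebra_simps)
    moreover have "2 * s * \<theta> (Suc k) \<le> (norm (y k - z))\<^sup>2 - (norm (x (Suc k) - z))\<^sup>2"
      using descent[of k, OF _ b] fin[of "Suc k"] k by (auto simp: \<theta>_def m_def algebra_simps)
    ultimately show "2 * s * ((real k)\<^sup>2 * \<theta> (Suc k) - real k * (real k - c) * \<theta> k)
        \<le> (norm (c *\<^sub>R (x k - z) + (real k - \<alpha>) *\<^sub>R (x k - x (k - 1))))\<^sup>2
          - (norm (c *\<^sub>R (x (Suc k) - z) + (real k - c) *\<^sub>R (x (Suc k) - x k)))\<^sup>2"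
      using k c assms(13)[of k] by (intro weighted_descent) auto
  qed (use \<open>0 < s\<close> nonneg in auto)
  also have "(\<lambda>k. 1 / real k powr \<beta>) \<in> O(\<lambda>k. 1 / real k powr p)"
  proof (rule bigoI[where c = 1])
    show "\<forall>\<^sub>F k in sequentially. norm (1 / real k powr \<beta>) \<le> 1 * norm (1 / real k powr p)"
      using eventually_ge_at_top[of 1] by eventually_elim (use \<beta>(3) in \<open>auto intro!: frac_le powr_mono\<close>)
  qed
  finally have "\<theta> \<in> O(\<lambda>k. 1 / real k powr p)" .
  moreover have "\<forall>\<^sub>F k in sequentially. real_of_ereal (sum_fun \<Phi> \<Psi> (x k) - (INF z. sum_fun \<Phi> \<Psi> z)) = \<theta> k"
    using eventually_ge_at_top[of 2] by eventually_elim (simp add: objective Inf)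
  moreover have "\<forall>\<^sub>F k in sequentially. sum_fun \<Phi> \<Psi> (x k) \<noteq> \<infinity>"
    using eventually_ge_at_top[of 2] by eventually_elim (simp add: objective)
  ultimately show ?thesis by (simp cong: landau_o.big.in_cong)
qed

end
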